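(* Let $f(A)=\mathrm{tr}\{\arctan A\}$ for $A\in\mathrm{Sym}^2(\mathbb R^n)$, and for $\theta\in(-n\frac\pi2,n\frac\pi2)$ let $\mathbf F_\theta=\{A:f(A)\ge\theta\}$. Then $f$ is tamable on $\mathbf F_\theta$ if and only if $\theta$ belongs to the highest phase interval $I_1=\left((n-2)\frac\pi2,n\frac\pi2\right)$. More specifically, if $\theta=(n-2)\frac\pi2+\delta\in I_1$ with $\delta>0$, then $A\mapsto\tan\{\frac1nf(A)\}$ is tame on $\mathbf F_\theta=f^{-1}\left([(n-2)\frac\pi2+\delta,n\frac\pi2)\right)$.
   Context: $\mathrm{Sym}^2(\mathbb R^n)$ is the space of real symmetric $n\times n$ matrices, and $\mathrm{tr}\{\arctan A\}$ is the sum of the arctangents of the eigenvalues of $A$. A function $g:\mathbf F\to\mathbb R$ on a subequation $\mathbf F\subset\mathrm{Sym}^2(\mathbb R^n)$ (a closed set with $\mathbf F+\{P\ge0\}\subset\mathbf F$) is tame on $\mathbf F$ if for every $t>0$ there exists $c(t)>0$ such that $g(A+tI)-g(A)\ge c(t)$ for all $A\in\mathbf F$. The operator $f$ is tamable on $\mathbf F$ if there exists a strictly increasing function $\chi:f(\mathbf F)\to\mathbb R$ such that $\chi\circ f$ is tame on $\mathbf F$. *)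

theory Defs
  imports "HOL-Analysis.Analysis"
begin

definition Sym2 :: "(real ^ 'n ^ 'n) set" where
  "Sym2 = {A. transpose A = A}"

definition psd :: "(real ^ 'n ^ 'n) set" where
  "psd = {P \<in> Sym2. \<forall>x. 0 \<le> x \<bullet> (P *v x)}"

definition eigenspace :: "real ^ 'n ^ 'n \<Rightarrow> real \<Rightarrow> (real ^ 'n) set" where
  "eigenspace A l = {x. A *v x = l *\<^sub>R x}"

definition eigenvalues :: "real ^ 'n ^ 'n \<Rightarrow> real set" where
  "eigenvalues A = {l. \<exists>x. x \<noteq> 0 \<and> A *v x = l *\<^sub>R x}"

text \<open>
  The sum of the arctangents of the eigenvalues, each eigenvalue counted with its multiplicity.
  The operator is only of interest on \<open>Sym2\<close>, where the algebraic and the geometric multiplicity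
  agree and all eigenvalues are real.
\<close>

definition tr_arctan :: "real ^ 'n ^ 'n \<Rightarrow> real" where
  "tr_arctan A = (\<Sum>l\<in>eigenvalues A. real (dim (eigenspace A l)) * arctan l)"

text \<open>
  \<open>Sym2\<close> is a closed subspace of the space of all matrices, so closedness in \<open>Sym2\<close> is the same
  as closedness in the ambient space.
\<close>

definition subequation :: "(real ^ 'n ^ 'n) set \<Rightarrow> bool" where
  "subequation F \<longleftrightarrow> F \<subseteq> Sym2 \<and> closed F \<and> (\<forall>A\<in>F. \<forall>P\<in>psd. A + P \<in> F)"

text \<open>
  Functions on \<open>F\<close> are represented by total functions. Only the values on \<open>F\<close> matter, since
  \<open>A + t *\<^sub>R mat 1\<close> belongs to a subequation \<open>F\<close> whenever \<open>A\<close> does and \<open>t > 0\<close>.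
\<close>

definition tame_on :: "(real ^ 'n ^ 'n) set \<Rightarrow> (real ^ 'n ^ 'n \<Rightarrow> real) \<Rightarrow> bool" where
  "tame_on F g \<longleftrightarrow> subequation F \<and>
     (\<forall>t>0. \<exists>c>0. \<forall>A\<in>F. g (A + t *\<^sub>R mat 1) - g A \<ge> c)"

definition tamable_on :: "(real ^ 'n ^ 'n) set \<Rightarrow> (real ^ 'n ^ 'n \<Rightarrow> real) \<Rightarrow> bool" where
  "tamable_on F f \<longleftrightarrow>
     (\<exists>h :: real \<Rightarrow> real. strict_mono_on (f ` F) h \<and> tame_on F (h \<circ> f))"

definition F_phase :: "real \<Rightarrow> (real ^ 'n ^ 'n) set" where
  "F_phase \<theta> = {A \<in> Sym2. tr_arctan A \<ge> \<theta>}"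

end

(* A symmetric matrix has an orthonormal eigenbasis, and by Weyl's monotonicity principle its ordered
   eigenvalues increase with the matrix; hence tr arctan is monotone and Lipschitz, and F_phase is a
   subequation. Along A + s I all eigenvalues move with speed 1. On the highest phase interval the
   smallest angle is bounded away from -pi/2, and this bounds the derivative in s of the tangent of
   the average angle from below by sin(delta)^2 / n.

   Conversely, let theta <= p = (n - 2) pi/2, so that p is a phase on F_phase. An increasing h has a finite
   right limit at p, and there are matrices A for which the phases of A and of A + I both lie just
   above p, so that h cannot increase by a fixed amount from A to A + I. *)
theory Submission
  imports Defs
begin

section \<open>The spectral theorem for real symmetric matrices\<close>

lemma Sym2_inner:
  fixes A :: "real ^ 'n ^ 'n"
  assumes "A \<in> Sym2"
  shows "(A *v x) \<bullet> y = x \<bullet> (A *v y)"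
proof -
  have "A *v x = x v* A" using assms vector_transpose_matrix[of x A] by (simp add: Sym2_def)
  then show ?thesis by (simp add: dot_lmul_matrix)
qed

(* A maximiser x of the Rayleigh quotient on the unit sphere of S is an eigenvector: with m the
   maximum, y \<mapsto> m (y \<bullet> y) - y \<bullet> A y is nonnegative on S and vanishes at x, so its derivative at x
   in the direction w = m x - A x \<in> S, which is 2 (w \<bullet> w), vanishes. *)
lemma Sym2_eigenvector_in_invariant_subspace:
  fixes A :: "real ^ 'n ^ 'n"
  assumes A: "A \<in> Sym2" and S: "subspace S" and inv: "\<And>x. x \<in> S \<Longrightarrow> A *v x \<in> S"
    and nz: "z \<in> S" "z \<noteq> 0"
  obtains x m where "x \<in> S" "norm x = 1" "A *v x = m *\<^sub>R x"
proof -
  let ?K = "S \<inter> sphere 0 1"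
  have "compact ?K" using closed_subspace[OF S] by (simp add: closed_Int_compact)
  moreover have "z /\<^sub>R norm z \<in> ?K" using nz S by (simp add: subspace_scale)
  moreover have "continuous_on ?K (\<lambda>x. x \<bullet> (A *v x))"
    by (intro continuous_intros matrix_vector_mult_linear_continuous_on)
  ultimately obtain x where x: "x \<in> ?K" and max: "\<And>y. y \<in> ?K \<Longrightarrow> y \<bullet> (A *v y) \<le> x \<bullet> (A *v x)"
    using continuous_attains_sup[of ?K "\<lambda>x. x \<bullet> (A *v x)"] by blast
  define m where "m = x \<bullet> (A *v x)"
  define Q where "Q y = m * (y \<bullet> y) - y \<bullet> (A *v y)" for y
  have Q_nonneg: "0 \<le> Q y" if "y \<in> S" for y
  proof (cases "y = 0")
    case False
    have "y /\<^sub>R norm y \<in> ?K" using that False S by (simp add: subspace_scale)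
    from max[OF this] have "(y \<bullet> (A *v y)) / (norm y)\<^sup>2 \<le> m"
      by (simp add: m_def scaleR_matrix_vector_assoc[symmetric] matrix_vector_mult_scaleR
          power2_eq_square divide_inverse mult_ac)
    then show ?thesis using False by (simp add: Q_def field_simps dot_square_norm)
  qed (simp add: Q_def)
  define w where "w = m *\<^sub>R x - A *v x"
  have w: "w \<in> S" using x inv S by (simp add: w_def subspace_diff subspace_scale)
  have xx: "x \<bullet> x = 1" using x by (simp add: dot_square_norm)
  have expand: "Q (x + t *\<^sub>R w) = 2 * t * (w \<bullet> w) + t\<^sup>2 * Q w" for t
  proof -
    have wAx: "w \<bullet> (A *v x) = m * (w \<bullet> x) - w \<bullet> w"
      by (subst (3) w_def) (simp add: inner_diff_right)
    moreover have "x \<bullet> (A *v w) = m * (w \<bullet> x) - w \<bullet> w"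
      using Sym2_inner[OF A] wAx by (metis inner_commute)
    moreover have "Q (x + t *\<^sub>R w) = m * (x \<bullet> x) - x \<bullet> (A *v x) + 2 * t * (m * (w \<bullet> x))
        - t * (w \<bullet> (A *v x)) - t * (x \<bullet> (A *v w)) + t\<^sup>2 * Q w"
      unfolding Q_def
      by (simp add: inner_commute[of x w] power2_eq_square algebra_simps)
    ultimately show ?thesis
      by (simp add: xx m_def[symmetric] right_diff_distrib)
  qed
  have "w \<bullet> w = 0"
  proof (rule ccontr)
    assume "w \<bullet> w \<noteq> 0"
    then have pos: "w \<bullet> w > 0" using inner_gt_zero_iff by fastforce
    have Qw: "0 \<le> Q w" by (rule Q_nonneg[OF w])
    \<comment> \<open>Moving along \<open>- w\<close>, the linear term
      \<open>2 * t * (w \<bullet> w)\<close> outweighs the quadratic one once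
      \<open>t * Q w \<le> w \<bullet> w\<close>; the \<open>+ 1\<close> avoids division by
      zero.\<close>
    define t where "t = (w \<bullet> w) / (Q w + 1)"
    have t: "t > 0" "t * Q w \<le> w \<bullet> w"
      using pos Qw by (auto simp: t_def field_simps)
    have "0 \<le> Q (x + (- t) *\<^sub>R w)"
      by (intro Q_nonneg subspace_add[OF S] subspace_scale[OF S]) (use x w in auto)
    also have "\<dots> = - t * (2 * (w \<bullet> w) - t * Q w)"
      unfolding expand by (simp add: power2_eq_square algebra_simps)
    also have "\<dots> < 0"
      using t pos by (intro mult_neg_pos) (simp, linarith)
    finally show False by simp
  qed
  then have "A *v x = m *\<^sub>R x" by (simp add: w_def)
  then show ?thesis using x by (intro that[of x m]) auto
qed

text \<open>A family indexed by \<open>'n\<close>, rather than a set, lists the eigenvalues with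
  multiplicity, so spectral sums become sums over \<open>UNIV\<close>.\<close>

definition is_eigenbasis :: "real ^ 'n ^ 'n \<Rightarrow> ('n \<Rightarrow> real ^ 'n) \<Rightarrow> ('n \<Rightarrow> real) \<Rightarrow> bool" where
  "is_eigenbasis A v l \<longleftrightarrow>
     (\<forall>i j. v i \<bullet> v j = (if i = j then 1 else 0)) \<and> (\<forall>i. A *v v i = l i *\<^sub>R v i)"

text \<open>An orthonormal set of eigenvectors is enlarged one at a time: by symmetry its orthogonal
  complement is invariant under \<open>A\<close>, and while fewer than n vectors are present that
  complement is nonzero and contains another eigenvector.\<close>

lemma Sym2_eigenbasis_exists:
  fixes A :: "real ^ 'n ^ 'n"
  assumes A: "A \<in> Sym2"
  obtains v l where "is_eigenbasis A v l"
proof -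
  have "\<exists>B. finite B \<and> card B = k \<and> pairwise orthogonal B \<and> (\<forall>b\<in>B. norm b = 1 \<and> (\<exists>m. A *v b = m *\<^sub>R b))"
    if "k \<le> CARD('n)" for k
    using that
  proof (induction k)
    case 0
    show ?case by (rule exI[of _ "{}"]) auto
  next
    case (Suc k)
    then obtain B where B: "finite B" "card B = k" "pairwise orthogonal B"
        "\<And>b. b \<in> B \<Longrightarrow> norm b = 1" "\<And>b. b \<in> B \<Longrightarrow> \<exists>m. A *v b = m *\<^sub>R b"
      by auto
    let ?S = "{x. \<forall>b\<in>B. orthogonal b x}"
    have "dim B < DIM(real ^ 'n)"
      using dim_le_card'[OF B(1)] B(2) Suc.prems by simp
    then obtain z where z: "z \<noteq> 0" "\<And>y. y \<in> span B \<Longrightarrow> orthogonal z y"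
      by (rule orthogonal_to_subspace_exists) blast
    have "subspace ?S" by (auto simp: subspace_def orthogonal_clauses)
    moreover have "A *v x \<in> ?S" if "x \<in> ?S" for x
    proof -
      have "b \<bullet> (A *v x) = 0" if b: "b \<in> B" for b
      proof -
        obtain m where "A *v b = m *\<^sub>R b" using B(5)[OF b] by blast
        then have "b \<bullet> (A *v x) = m * (b \<bullet> x)" by (simp add: Sym2_inner[OF A, symmetric])
        then show ?thesis using \<open>x \<in> ?S\<close> b by (simp add: orthogonal_def)
      qed
      then show ?thesis by (simp add: orthogonal_def)
    qed
    moreover have "z \<in> ?S" using z(2) orthogonal_commute span_base by blast
    ultimately obtain x m where x: "x \<in> ?S" "norm x = 1" "A *v x = m *\<^sub>R x"
      using z(1) by (rule Sym2_eigenvector_in_invariant_subspace[OF A])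
    have "x \<notin> B"
    proof
      assume "x \<in> B"
      then have "x \<bullet> x = 0" using x(1) by (simp add: orthogonal_def)
      then show False using x(2) by simp
    qed
    then have "card (insert x B) = Suc k" using B(1,2) by simp
    moreover have "finite (insert x B)" using B(1) by simp
    moreover have "pairwise orthogonal (insert x B)"
      unfolding pairwise_insert using B(3) x(1) orthogonal_commute by blast
    moreover have "\<forall>b\<in>insert x B. norm b = 1 \<and> (\<exists>m. A *v b = m *\<^sub>R b)"
      using B(4,5) x(2,3) by blast
    ultimately show ?case by blast
  qed
  from this[OF order_refl] obtain B :: "(real ^ 'n) set" where
    B: "finite B" "card B = CARD('n)" "pairwise orthogonal B"
       "\<And>b. b \<in> B \<Longrightarrow> norm b = 1" "\<And>b. b \<in> B \<Longrightarrow> \<exists>m. A *v b = m *\<^sub>R b"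
    by blast
  obtain v where v: "bij_betw v (UNIV :: 'n set) B"
    using finite_same_card_bij[OF _ B(1)] B(2) by (metis finite_class.finite_UNIV)
  have vB: "v i \<in> B" for i using v by (auto simp: bij_betw_def)
  have "\<forall>i. \<exists>m. A *v v i = m *\<^sub>R v i" using vB B(5) by blast
  then obtain l where l: "\<And>i. A *v v i = l i *\<^sub>R v i" by metis
  have "v i \<bullet> v j = (if i = j then 1 else 0)" for i j
  proof (cases "i = j")
    case True
    then show ?thesis using B(4)[OF vB[of i]] by (simp add: dot_square_norm)
  next
    case False
    then have "v i \<noteq> v j" using v by (auto simp: bij_betw_def inj_on_def)
    then show ?thesis using B(3) vB False by (auto simp: pairwise_def orthogonal_def)
  qed
  then show ?thesis using l by (intro that[of v l]) (simp add: is_eigenbasis_def)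
qed

lemma is_eigenbasis_add_identity:
  assumes "is_eigenbasis A v l"
  shows "is_eigenbasis (A + t *\<^sub>R mat 1) v (\<lambda>i. l i + t)"
proof -
  have "(A + t *\<^sub>R mat 1) *v v i = (l i + t) *\<^sub>R v i" for i
  proof -
    have "(A + t *\<^sub>R mat 1) *v v i = A *v v i + t *\<^sub>R (mat 1 *v v i)"
      unfolding matrix_vector_mult_add_rdistrib scaleR_matrix_vector_assoc ..
    then show ?thesis using assms by (simp add: is_eigenbasis_def scaleR_left_distrib)
  qed
  then show ?thesis using assms by (simp add: is_eigenbasis_def)
qed

section \<open>Coordinates in an eigenbasis\<close>

lemma eigenbasis_independent:
  assumes "is_eigenbasis A v l"
  shows "inj v" and "independent (v ` I)"
proof -
  have o: "v i \<bullet> v j = (if i = j then 1 else 0)" for i j using assms by (simp add: is_eigenbasis_def)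
  show "inj v"
    by (rule injI) (metis o zero_neq_one)
  have "v i \<noteq> 0" for i using o[of i i] by auto
  then show "independent (v ` I)"
    by (intro pairwise_orthogonal_independent)
       (auto simp: pairwise_def orthogonal_def o)
qed

lemma dim_span_eigenbasis:
  assumes "is_eigenbasis A v l"
  shows "dim (span (v ` I)) = card I"
  using eigenbasis_independent(1)[OF assms] eigenbasis_independent(2)[OF assms, of I]
  by (simp add: dim_eq_card_independent card_image inj_on_subset)

text \<open>By dimension the basis spans the whole space, so the remainder \<open>d\<close> lies in
  a span to which it is orthogonal.\<close>

lemma eigenbasis_expansion:
  fixes A :: "real ^ 'n ^ 'n"
  assumes v: "is_eigenbasis A v l"
  shows "x = (\<Sum>i\<in>UNIV. (x \<bullet> v i) *\<^sub>R v i)"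
proof -
  have o: "v i \<bullet> v j = (if i = j then 1 else 0)" for i j using v by (simp add: is_eigenbasis_def)
  have "dim (span (v ` UNIV)) = DIM(real ^ 'n)"
    using dim_span_eigenbasis[OF v, of UNIV] by simp
  then have "span (range v) = UNIV" using dim_eq_full[of "range v"] by simp
  moreover define d where "d = x - (\<Sum>i\<in>UNIV. (x \<bullet> v i) *\<^sub>R v i)"
  ultimately have "d \<in> span (range v)" by simp
  moreover have "orthogonal d (v j)" for j
    by (simp add: d_def orthogonal_def inner_diff_left inner_sum_left o if_distrib cong: if_cong)
  ultimately have "orthogonal d d" by (metis (no_types) orthogonal_to_span rangeE)
  then show ?thesis by (simp add: d_def orthogonal_def)
qed

lemma eigenbasis_inner:
  assumes v: "is_eigenbasis A v l"
  shows "x \<bullet> y = (\<Sum>i\<in>UNIV. (x \<bullet> v i) * (y \<bullet> v i))"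
proof -
  have "x \<bullet> y = x \<bullet> (\<Sum>i\<in>UNIV. (y \<bullet> v i) *\<^sub>R v i)"
    by (rule arg_cong[OF eigenbasis_expansion[OF v]])
  then show ?thesis by (simp add: inner_sum_right mult.commute)
qed

lemma eigenbasis_mult_inner:
  assumes v: "is_eigenbasis A v l"
  shows "(A *v x) \<bullet> v i = l i * (x \<bullet> v i)"
proof -
  have o: "v i \<bullet> v j = (if i = j then 1 else 0)" and e: "A *v v i = l i *\<^sub>R v i" for i j
    using v by (auto simp: is_eigenbasis_def)
  have "A *v x = A *v (\<Sum>j\<in>UNIV. (x \<bullet> v j) *\<^sub>R v j)"
    by (rule arg_cong[OF eigenbasis_expansion[OF v]])
  also have "\<dots> = (\<Sum>j\<in>UNIV. (x \<bullet> v j * l j) *\<^sub>R v j)"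
    by (simp add: linear_sum[OF matrix_vector_mul_linear] matrix_vector_mult_scaleR e)
  finally show ?thesis by (simp add: inner_sum_left o if_distrib cong: if_cong)
qed

text \<open>Comparing coordinates in \<open>A *v x = m *\<^sub>R x\<close> kills every coordinate
  whose eigenvalue differs from \<open>m\<close>.\<close>

lemma eigenspace_eigenbasis:
  assumes v: "is_eigenbasis A v l"
  shows "eigenspace A m = span (v ` {i. l i = m})"
proof
  show "eigenspace A m \<subseteq> span (v ` {i. l i = m})"
  proof
    fix x assume "x \<in> eigenspace A m"
    then have "A *v x = m *\<^sub>R x" by (simp add: eigenspace_def)
    then have eq: "l i * (x \<bullet> v i) = m * (x \<bullet> v i)" for i
      using eigenbasis_mult_inner[OF v, of x i] by (metis inner_scaleR_left)
    have "(x \<bullet> v i) *\<^sub>R v i \<in> span (v ` {i. l i = m})" for i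
    proof (cases "l i = m")
      case True
      then show ?thesis by (intro span_scale span_base) auto
    next
      case False
      then show ?thesis using eq[of i] by (simp add: span_zero)
    qed
    then show "x \<in> span (v ` {i. l i = m})"
      by (subst eigenbasis_expansion[OF v, of x]) (rule span_sum)
  qed
  have "subspace (eigenspace A m)"
    by (auto simp: eigenspace_def subspace_def matrix_vector_right_distrib
        matrix_vector_mult_scaleR scaleR_right_distrib)
  moreover have "v ` {i. l i = m} \<subseteq> eigenspace A m"
    using v by (auto simp: eigenspace_def is_eigenbasis_def)
  ultimately show "span (v ` {i. l i = m}) \<subseteq> eigenspace A m" by (rule span_minimal[rotated])
qed

text \<open>The dimension of an eigenspace counts the indices carrying that eigenvalue, so the
  defining sum is the sum over indices grouped by fibres of \<open>l\<close>.\<close>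

lemma tr_arctan_eigenbasis:
  assumes v: "is_eigenbasis A v l"
  shows "tr_arctan A = (\<Sum>i\<in>UNIV. arctan (l i))"
proof -
  have "eigenvalues A = range l"
  proof
    show "eigenvalues A \<subseteq> range l"
    proof
      fix m assume "m \<in> eigenvalues A"
      then obtain x where "x \<noteq> 0" "x \<in> eigenspace A m"
        by (auto simp: eigenvalues_def eigenspace_def)
      then have "{i. l i = m} \<noteq> {}" 
        using eigenspace_eigenbasis[OF v] by (metis image_empty singletonD span_empty)
      then show "m \<in> range l" by auto
    qed
    have "v i \<noteq> 0" for i using v by (metis is_eigenbasis_def inner_zero_left zero_neq_one)
    then show "range l \<subseteq> eigenvalues A"
      using v unfolding eigenvalues_def is_eigenbasis_def by blast
  qed
  moreover have "dim (eigenspace A m) = card {i. l i = m}" for m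
    using dim_span_eigenbasis[OF v] by (simp add: eigenspace_eigenbasis[OF v])
  ultimately have "tr_arctan A = (\<Sum>m\<in>range l. \<Sum>i | l i = m. arctan (l i))"
    unfolding tr_arctan_def by (intro sum.cong) simp_all
  also have "\<dots> = (\<Sum>i\<in>UNIV. arctan (l i))"
    using sum.image_gen[of UNIV "\<lambda>i. arctan (l i)" l] by (simp only: finite_class.finite_UNIV UNIV_I simp_thms)
  finally show ?thesis .
qed

section \<open>Monotonicity and continuity of the operator\<close>

text \<open>Weyl's principle in counting form. For nonzero x the form of \<open>A\<close> exceeds
  \<open>s * (x \<bullet> x)\<close> on \<open>?U\<close>, while that of \<open>B\<close> is at most
  this on \<open>?W\<close>. Hence the two subspaces meet only in 0 and their dimensions add up to
  at most n.\<close>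

lemma card_eigenvalues_mono:
  fixes A B :: "real ^ 'n ^ 'n"
  assumes v: "is_eigenbasis A v l" and w: "is_eigenbasis B w m"
    and le: "\<And>x. x \<bullet> (A *v x) \<le> x \<bullet> (B *v x)"
  shows "card {i. l i > s} \<le> card {i. m i > s}"
proof -
  let ?U = "span (v ` {i. l i > s})" and ?W = "span (w ` {i. \<not> m i > s})"
  have coord: "x \<bullet> u i = 0" if "is_eigenbasis C u k" "x \<in> span (u ` I)" "i \<notin> I"
    for C :: "real ^ 'n ^ 'n" and u k x i I
  proof -
    have "orthogonal (u i) (u j)" if "j \<in> I" for j
      using \<open>is_eigenbasis C u k\<close> \<open>i \<notin> I\<close> that by (auto simp: is_eigenbasis_def orthogonal_def)
    then have "orthogonal (u i) x" by (intro orthogonal_to_span[OF that(2)]) auto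
    then show ?thesis by (simp add: orthogonal_def inner_commute)
  qed
  have "x = 0" if x: "x \<in> ?U" "x \<in> ?W" for x
  proof (rule ccontr)
    assume "x \<noteq> 0"
    \<comment> \<open>A nonzero coordinate makes the first comparison below strict.\<close>
    have "\<exists>j. x \<bullet> v j \<noteq> 0"
    proof (rule ccontr)
      assume "\<not> (\<exists>j. x \<bullet> v j \<noteq> 0)"
      then have "(\<Sum>i\<in>UNIV. (x \<bullet> v i) *\<^sub>R v i) = 0" by simp
      then have "x = 0" by (rule trans[OF eigenbasis_expansion[OF v]])
      then show False using \<open>x \<noteq> 0\<close> by simp
    qed
    then obtain j where j: "x \<bullet> v j \<noteq> 0" by blast
    have cv: "l i > s \<or> x \<bullet> v i = 0" for i using coord[OF v x(1), of i] by auto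
    have "s * (x \<bullet> x) = (\<Sum>i\<in>UNIV. s * (x \<bullet> v i)\<^sup>2)"
      unfolding eigenbasis_inner[OF v, of x x] by (simp add: sum_distrib_left power2_eq_square)
    also have "\<dots> < (\<Sum>i\<in>UNIV. l i * (x \<bullet> v i)\<^sup>2)"
    proof (rule sum_strict_mono_ex1)
      show "\<forall>i\<in>UNIV. s * (x \<bullet> v i)\<^sup>2 \<le> l i * (x \<bullet> v i)\<^sup>2"
      proof
        fix i show "s * (x \<bullet> v i)\<^sup>2 \<le> l i * (x \<bullet> v i)\<^sup>2"
          using cv[of i] by (auto intro: mult_right_mono)
      qed
      show "\<exists>i\<in>UNIV. s * (x \<bullet> v i)\<^sup>2 < l i * (x \<bullet> v i)\<^sup>2"
        using cv[of j] j by (auto intro!: exI[of _ j])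
    qed simp
    also have "\<dots> = x \<bullet> (A *v x)"
      unfolding eigenbasis_inner[OF v, of x "A *v x"] eigenbasis_mult_inner[OF v]
      by (simp add: power2_eq_square mult_ac)
    also have "\<dots> \<le> x \<bullet> (B *v x)" by (rule le)
    also have "\<dots> = (\<Sum>i\<in>UNIV. m i * (x \<bullet> w i)\<^sup>2)"
      unfolding eigenbasis_inner[OF w, of x "B *v x"] eigenbasis_mult_inner[OF w]
      by (simp add: power2_eq_square mult_ac)
    also have "\<dots> \<le> (\<Sum>i\<in>UNIV. s * (x \<bullet> w i)\<^sup>2)"
    proof (rule sum_mono)
      fix i
      have "m i \<le> s \<or> x \<bullet> w i = 0" using coord[OF w x(2), of i] by (auto simp: not_less)
      then show "m i * (x \<bullet> w i)\<^sup>2 \<le> s * (x \<bullet> w i)\<^sup>2" by (auto intro: mult_right_mono)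
    qed
    also have "\<dots> = s * (x \<bullet> x)"
      unfolding eigenbasis_inner[OF w, of x x] by (simp add: sum_distrib_left power2_eq_square)
    finally show False by simp
  qed
  then have "?U \<inter> ?W \<subseteq> {0}" by auto
  then have "dim (?U \<inter> ?W) = 0" by simp
  then have "dim ?U + dim ?W = dim {x + y |x y. x \<in> ?U \<and> y \<in> ?W}"
    using dim_sums_Int[of ?U ?W, OF subspace_span subspace_span] by linarith
  also have "\<dots> \<le> CARD('n)" by (rule dim_subset_UNIV_cart)
  finally have "card {i. l i > s} + card {i. \<not> m i > s} \<le> CARD('n)"
    by (simp only: dim_span_eigenbasis[OF v] dim_span_eigenbasis[OF w])
  moreover have "{i. m i > s} \<union> {i. \<not> m i > s} = UNIV" "{i. m i > s} \<inter> {i. \<not> m i > s} = {}"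
    by auto
  then have "card {i. m i > s} + card {i. \<not> m i > s} = CARD('n)"
    using card_Un_disjoint[of "{i. m i > s}" "{i. \<not> m i > s}"] by simp
  ultimately show ?thesis by linarith
qed

text \<open>This takes the place of sorting the eigenvalues: a minimiser of \<open>f\<close> is
  paired with a minimiser of \<open>g\<close>, and induction treats the rest.\<close>

lemma exists_dominating_bijection:
  fixes f :: "'a \<Rightarrow> real" and g :: "'b \<Rightarrow> real"
  assumes "finite S" "finite T" "card S = card T"
    and "\<And>s. card {x \<in> S. f x > s} \<le> card {y \<in> T. g y > s}"
  shows "\<exists>\<sigma>. bij_betw \<sigma> S T \<and> (\<forall>x\<in>S. f x \<le> g (\<sigma> x))"
  using assms
proof (induction "card S" arbitrary: S T)
  case 0
  then have "S = {}" "T = {}" by auto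
  then show ?case by (auto simp: bij_betw_def)
next
  case (Suc n)
  have ne: "S \<noteq> {}" "T \<noteq> {}" using Suc.hyps(2) Suc.prems by auto
  obtain a where a: "a \<in> S" "\<And>x. x \<in> S \<Longrightarrow> f a \<le> f x"
    using arg_min_if_finite[OF Suc.prems(1) ne(1), of f] by (metis not_le)
  obtain b where b: "b \<in> T" "\<And>y. y \<in> T \<Longrightarrow> g b \<le> g y"
    using arg_min_if_finite[OF Suc.prems(2) ne(2), of g] by (metis not_le)
  \<comment> \<open>Otherwise the threshold \<open>g b\<close> would count all of \<open>S\<close>
    but miss \<open>b\<close> in \<open>T\<close>.\<close>
  have ab: "f a \<le> g b"
  proof (rule ccontr)
    assume "\<not> f a \<le> g b"
    then have less: "g b < f a" by simp
    have "{x \<in> S. f x > g b} = S" using a less by fastforce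
    moreover have "card {y \<in> T. g y > g b} < card T"
      using b Suc.prems(2) by (intro psubset_card_mono) auto
    ultimately show False using Suc.prems(4)[of "g b"] Suc.prems(3) by simp
  qed
  have card': "card (S - {a}) = n" "card (T - {b}) = n"
    using Suc.hyps(2) Suc.prems a b by auto
  \<comment> \<open>Below \<open>g b\<close> every remaining element of \<open>T\<close> is counted;
    from \<open>g b\<close> on, neither \<open>a\<close> nor \<open>b\<close> was counted, so both
    counts are unchanged.\<close>
  have "card {x \<in> S - {a}. f x > s} \<le> card {y \<in> T - {b}. g y > s}" for s
  proof (cases "g b > s")
    case True
    then have "{y \<in> T - {b}. g y > s} = T - {b}" using b by fastforce
    moreover have "card {x \<in> S - {a}. f x > s} \<le> card (S - {a})"
      using Suc.prems(1) by (intro card_mono) auto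
    ultimately show ?thesis using card' by simp
  next
    case False
    then have "{y \<in> T - {b}. g y > s} = {y \<in> T. g y > s}" by auto
    moreover have "{x \<in> S - {a}. f x > s} = {x \<in> S. f x > s}" using False ab by auto
    ultimately show ?thesis using Suc.prems(4) by simp
  qed
  with Suc.hyps(1)[of "S - {a}" "T - {b}"] card' Suc.prems obtain \<sigma> where
    \<sigma>: "bij_betw \<sigma> (S - {a}) (T - {b})" "\<forall>x\<in>S - {a}. f x \<le> g (\<sigma> x)"
    by auto
  have "bij_betw (\<sigma>(a := b)) (S - {a}) (T - {b})"
    using \<sigma>(1) by (rule bij_betw_cong[THEN iffD1, rotated]) auto
  then have "bij_betw (\<sigma>(a := b)) (S - {a} \<union> {a}) (T - {b} \<union> {b})"
    using notIn_Un_bij_betw[of a "S - {a}" "\<sigma>(a := b)" "T - {b}"] by simp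
  then show ?case using \<sigma>(2) ab a(1) b(1)
    by (intro exI[of _ "\<sigma>(a := b)"]) (auto simp: insert_absorb)
qed

lemma tr_arctan_mono:
  fixes A B :: "real ^ 'n ^ 'n"
  assumes "A \<in> Sym2" "B \<in> Sym2" and le: "\<And>x. x \<bullet> (A *v x) \<le> x \<bullet> (B *v x)"
  shows "tr_arctan A \<le> tr_arctan B"
proof -
  obtain v l where v: "is_eigenbasis A v l" using Sym2_eigenbasis_exists[OF assms(1)] .
  obtain w m where w: "is_eigenbasis B w m" using Sym2_eigenbasis_exists[OF assms(2)] .
  obtain \<sigma> where \<sigma>: "bij \<sigma>" "\<And>i. l i \<le> m (\<sigma> i)"
    using exists_dominating_bijection[of UNIV UNIV l m] card_eigenvalues_mono[OF v w le] by auto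
  have "tr_arctan A \<le> (\<Sum>i\<in>UNIV. arctan (m (\<sigma> i)))"
    unfolding tr_arctan_eigenbasis[OF v] by (intro sum_mono) (simp add: \<sigma>(2) arctan_monotone')
  also have "\<dots> = tr_arctan B"
    unfolding tr_arctan_eigenbasis[OF w] using \<sigma>(1) by (rule sum.reindex_bij_betw)
  finally show ?thesis .
qed

section \<open>Lipschitz continuity and the subequation property\<close>

lemma arctan_add_le:
  fixes x t :: real
  assumes "0 \<le> t"
  shows "arctan (x + t) \<le> arctan x + t"
proof -
  have deriv: "\<exists>y. ((\<lambda>s. s - arctan s) has_real_derivative y) (at s) \<and> 0 \<le> y" for s :: real
  proof (intro exI conjI)
    show "((\<lambda>s. s - arctan s) has_real_derivative 1 - inverse (1 + s\<^sup>2)) (at s)"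
      by (intro DERIV_diff DERIV_ident DERIV_arctan)
    show "0 \<le> 1 - inverse (1 + s\<^sup>2)" by (simp add: inverse_le_1_iff)
  qed
  have "x - arctan x \<le> (x + t) - arctan (x + t)"
    by (rule DERIV_nonneg_imp_nondecreasing[of x "x + t" "\<lambda>s. s - arctan s"])
      (use assms deriv in auto)
  then show ?thesis by simp
qed

lemma Sym2_add: "A \<in> Sym2 \<Longrightarrow> B \<in> Sym2 \<Longrightarrow> A + B \<in> Sym2"
  by (simp add: Sym2_def transpose_def vec_eq_iff)

lemma Sym2_scaled_identity: "t *\<^sub>R mat 1 \<in> Sym2"
  by (simp add: Sym2_def transpose_scalar)

lemma tr_arctan_add_identity_le:
  fixes A :: "real ^ 'n ^ 'n"
  assumes "A \<in> Sym2" "0 \<le> t"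
  shows "tr_arctan (A + t *\<^sub>R mat 1) \<le> tr_arctan A + real CARD('n) * t"
proof -
  obtain v l where v: "is_eigenbasis A v l" using Sym2_eigenbasis_exists[OF assms(1)] .
  have "tr_arctan (A + t *\<^sub>R mat 1) \<le> (\<Sum>i\<in>UNIV. arctan (l i) + t)"
    unfolding tr_arctan_eigenbasis[OF is_eigenbasis_add_identity[OF v]]
    by (intro sum_mono arctan_add_le assms)
  then show ?thesis by (simp add: tr_arctan_eigenbasis[OF v] sum.distrib)
qed

text \<open>The constant is crude, coming from bounding each entry by \<open>norm A\<close>; any
  constant serves the Lipschitz estimate.\<close>

lemma norm_matrix_vector_mult_le:
  fixes A :: "real ^ 'n ^ 'n"
  shows "norm (A *v x) \<le> (real CARD('n))\<^sup>2 * norm A * norm x"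
proof -
  have "\<bar>A $ i $ j\<bar> \<le> norm A" for i j
    using Finite_Cartesian_Product.norm_nth_le[of "A $ i" j] Finite_Cartesian_Product.norm_nth_le[of A i] by simp
  then have "onorm ((*v) A) \<le> (real CARD('n))\<^sup>2 * norm A"
    using onorm_le_matrix_component[of A "norm A"] by (simp add: power2_eq_square)
  moreover have "norm (A *v x) \<le> onorm ((*v) A) * norm x"
    by (rule onorm) simp
  ultimately show ?thesis by (meson mult_right_mono norm_ge_zero order_trans)
qed

text \<open>As quadratic forms, \<open>A\<close> is at most \<open>B\<close> plus a multiple of the
  identity proportional to \<open>dist A B\<close>. Monotonicity and the bound for identity shifts
  then give a Lipschitz estimate.\<close>

lemma continuous_on_tr_arctan: "continuous_on Sym2 (tr_arctan :: real ^ 'n ^ 'n \<Rightarrow> real)"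
proof -
  let ?C = "(real CARD('n))\<^sup>2"
  have *: "tr_arctan A - tr_arctan B \<le> (real CARD('n) * ?C) * dist A B"
    if AB: "A \<in> Sym2" "B \<in> Sym2" for A B :: "real ^ 'n ^ 'n"
  proof -
    let ?t = "?C * dist A B"
    have "x \<bullet> (A *v x) \<le> x \<bullet> ((B + ?t *\<^sub>R mat 1) *v x)" for x
    proof -
      have "x \<bullet> ((A - B) *v x) \<le> norm x * norm ((A - B) *v x)" by (rule norm_cauchy_schwarz)
      also have "\<dots> \<le> norm x * (?C * norm (A - B) * norm x)"
        by (intro mult_left_mono norm_matrix_vector_mult_le) simp
      also have "\<dots> = ?t * (x \<bullet> x)" by (simp add: dist_norm dot_square_norm power2_eq_square)
      finally show ?thesis
        by (simp add: matrix_vector_mult_diff_rdistrib matrix_vector_mult_add_rdistrib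
            inner_diff_right inner_add_right scaleR_matrix_vector_assoc[symmetric])
    qed
    then have "tr_arctan A \<le> tr_arctan (B + ?t *\<^sub>R mat 1)"
      using AB by (intro tr_arctan_mono Sym2_add Sym2_scaled_identity)
    also have "\<dots> \<le> tr_arctan B + real CARD('n) * ?t"
      by (intro tr_arctan_add_identity_le AB) simp
    finally show ?thesis by simp
  qed
  have "(real CARD('n) * ?C)-lipschitz_on Sym2 (tr_arctan :: real ^ 'n ^ 'n \<Rightarrow> real)"
  proof (rule lipschitz_onI)
    fix A B :: "real ^ 'n ^ 'n" assume "A \<in> Sym2" "B \<in> Sym2"
    then show "dist (tr_arctan A) (tr_arctan B) \<le> (real CARD('n) * ?C) * dist A B"
      using *[of A B] *[of B A] by (simp add: dist_real_def dist_commute abs_le_iff)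
  qed simp
  then show ?thesis by (rule lipschitz_on_continuous_on)
qed

lemma subequation_F_phase: "subequation (F_phase \<theta> :: (real ^ 'n ^ 'n) set)"
proof -
  have "closed (Sym2 :: (real ^ 'n ^ 'n) set)"
    unfolding Sym2_def transpose_def
    by (intro closed_Collect_eq continuous_intros)
  then have "closed (F_phase \<theta> :: (real ^ 'n ^ 'n) set)"
    using continuous_on_closed_Collect_le[OF continuous_on_const continuous_on_tr_arctan]
    by (simp add: F_phase_def)
  moreover have "A + P \<in> F_phase \<theta>" if "A \<in> F_phase \<theta>" "P \<in> psd" for A P :: "real ^ 'n ^ 'n"
  proof -
    have AP: "A \<in> Sym2" "A + P \<in> Sym2" using that by (auto simp: F_phase_def psd_def Sym2_add)
    have "tr_arctan A \<le> tr_arctan (A + P)"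
      using that by (intro tr_arctan_mono AP)
        (simp add: psd_def matrix_vector_mult_add_rdistrib inner_add_right)
    then show ?thesis using that AP by (simp add: F_phase_def)
  qed
  ultimately show ?thesis by (auto simp: subequation_def F_phase_def)
qed

section \<open>Tameness on the highest phase interval\<close>

lemma tr_arctan_less:
  fixes A :: "real ^ 'n ^ 'n"
  assumes "A \<in> Sym2"
  shows "\<bar>tr_arctan A\<bar> < real CARD('n) * (pi / 2)"
proof -
  obtain v l where v: "is_eigenbasis A v l" using Sym2_eigenbasis_exists[OF assms] .
  have "\<bar>\<Sum>i\<in>UNIV. arctan (l i)\<bar> \<le> (\<Sum>i\<in>UNIV. \<bar>arctan (l i)\<bar>)" by (rule sum_abs)
  also have "\<dots> < (\<Sum>i\<in>(UNIV :: 'n set). pi / 2)"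
  proof (rule sum_strict_mono)
    fix i show "\<bar>arctan (l i)\<bar> < pi / 2" using arctan_bounded[of "l i"] by linarith
  qed auto
  finally show ?thesis by (simp add: tr_arctan_eigenbasis[OF v])
qed

(* The smallest angle m lies below the average, and above \<delta> - pi/2 because all the others are
   below pi/2; if m \<ge> 0 then cos m \<ge> cos (average), and otherwise cos m \<ge> sin \<delta>. *)
lemma sum_derivative_arctan_ge:
  fixes l :: "'n::finite \<Rightarrow> real"
  defines "S \<equiv> \<Sum>i\<in>UNIV. arctan (l i)"
  assumes \<delta>: "0 < \<delta>" "\<delta> < pi" and S: "(real CARD('n) - 2) * (pi / 2) + \<delta> \<le> S"
  shows "(sin \<delta>)\<^sup>2 * (cos (S / real CARD('n)))\<^sup>2 \<le> (\<Sum>i\<in>UNIV. inverse (1 + (l i)\<^sup>2))"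
    and "cos (S / real CARD('n)) > 0"
proof -
  let ?N = "real CARD('n)"
  obtain j where j: "\<And>i. l j \<le> l i"
    using arg_min_if_finite[of UNIV l] by (metis UNIV_I UNIV_not_empty finite_class.finite_UNIV not_le)
  define m where "m = arctan (l j)"
  have N: "?N > 0" by simp
  have "?N * m \<le> S"
    unfolding S_def m_def using sum_bounded_below[of UNIV "arctan (l j)" "\<lambda>i. arctan (l i)"]
    by (simp add: j arctan_monotone')
  then have m_avg: "m \<le> S / ?N" using N by (simp add: field_simps)
  have "S < (\<Sum>i\<in>(UNIV :: 'n set). pi / 2)"
    unfolding S_def by (intro sum_strict_mono arctan_ubound) auto
  then have avg: "S / ?N < pi / 2" using N by (simp add: field_simps)
  have S_split: "S = m + (\<Sum>i\<in>UNIV - {j}. arctan (l i))"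
    unfolding S_def m_def by (subst sum.remove[of UNIV j]) auto
  have "(\<Sum>i\<in>UNIV - {j}. arctan (l i)) \<le> (\<Sum>i\<in>UNIV - {j}. pi / 2)"
    by (intro sum_mono less_imp_le arctan_ubound)
  also have "\<dots> = (?N - 1) * (pi / 2)"
    by (simp add: card_Diff_singleton Suc_leI)
  finally have m_low: "\<delta> - pi / 2 \<le> m" using S S_split by (simp add: field_simps)
  have m_low': "- (pi / 2) < m" by (simp add: m_def arctan_lbound)
  show cos_pos: "cos (S / ?N) > 0"
    using m_avg m_low' avg by (intro cos_gt_zero_pi) auto
  have sin_nonneg: "0 \<le> sin \<delta>" using \<delta> by (intro sin_ge_zero) auto
  have "sin \<delta> * cos (S / ?N) \<le> cos m"
  proof (cases "m \<ge> 0")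
    case True
    have "sin \<delta> * cos (S / ?N) \<le> 1 * cos (S / ?N)" using cos_pos by (intro mult_right_mono) auto
    also have "\<dots> \<le> cos m" unfolding mult_1 by (rule cos_monotone_0_pi_le) (use True m_avg avg in linarith)+
    finally show ?thesis .
  next
    case False
    have "sin \<delta> * cos (S / ?N) \<le> sin \<delta> * 1" using sin_nonneg by (intro mult_left_mono) auto
    also have "\<dots> = cos (\<delta> - pi / 2)" by (simp add: cos_diff)
    also have "\<dots> \<le> cos m" using False m_low \<delta> by (intro cos_monotone_minus_pi_0') auto
    finally show ?thesis .
  qed
  then have "(sin \<delta> * cos (S / ?N))\<^sup>2 \<le> (cos m)\<^sup>2"
    using sin_nonneg cos_pos by (intro power_mono) auto
  \<comment> \<open>The squared cosine of the smallest angle is the derivative of arctan at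
    \<open>l j\<close>, one term of a sum of positive terms.\<close>
  also have "(cos m)\<^sup>2 = inverse (1 + (l j)\<^sup>2)"
    by (simp add: m_def cos_arctan power_divide inverse_eq_divide)
  also have "\<dots> \<le> (\<Sum>i\<in>UNIV. inverse (1 + (l i)\<^sup>2))"
    by (rule member_le_sum) auto
  finally show "(sin \<delta>)\<^sup>2 * (cos (S / ?N))\<^sup>2 \<le> (\<Sum>i\<in>UNIV. inverse (1 + (l i)\<^sup>2))"
    by (simp add: power_mult_distrib)
qed

text \<open>The tangent of the average angle has derivative \<open>?d s / ?N\<close> divided by the
  squared cosine of that average. The preceding estimate bounds this below by \<open>?k\<close>, so
  subtracting \<open>?k * s\<close> leaves a nondecreasing function.\<close>

lemma tan_average_arctan_increment:
  fixes l :: "'n::finite \<Rightarrow> real"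
  assumes \<delta>: "0 < \<delta>" "\<delta> < pi" and t: "0 \<le> t"
    and S: "(real CARD('n) - 2) * (pi / 2) + \<delta> \<le> (\<Sum>i\<in>UNIV. arctan (l i))"
  shows "(sin \<delta>)\<^sup>2 / real CARD('n) * t \<le>
    tan ((\<Sum>i\<in>UNIV. arctan (l i + t)) / real CARD('n)) - tan ((\<Sum>i\<in>UNIV. arctan (l i)) / real CARD('n))"
proof -
  let ?N = "real CARD('n)" and ?k = "(sin \<delta>)\<^sup>2 / real CARD('n)"
  let ?a = "\<lambda>s. (\<Sum>i\<in>UNIV. arctan (l i + s)) / ?N"
  let ?d = "\<lambda>s. \<Sum>i\<in>UNIV. inverse (1 + (l i + s)\<^sup>2)"
  have deriv: "\<exists>y. ((\<lambda>s. tan (?a s) - ?k * s) has_real_derivative y) (at s) \<and> 0 \<le> y" if "0 \<le> s" for s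
  proof (intro exI conjI)
    \<comment> \<open>The phase only grows with \<open>s\<close>, so the lower bound persists along
      the whole ray.\<close>
    have "(\<Sum>i\<in>UNIV. arctan (l i)) \<le> (\<Sum>i\<in>UNIV. arctan (l i + s))"
      using that by (intro sum_mono arctan_monotone') simp
    then have S': "(?N - 2) * (pi / 2) + \<delta> \<le> (\<Sum>i\<in>UNIV. arctan (l i + s))" using S by linarith
    have pos: "cos (?a s) > 0" by (rule sum_derivative_arctan_ge(2)[OF \<delta> S'])
    have bound: "(sin \<delta>)\<^sup>2 * (cos (?a s))\<^sup>2 \<le> ?d s" by (rule sum_derivative_arctan_ge(1)[OF \<delta> S'])
    have "((\<lambda>s. arctan (l i + s)) has_real_derivative inverse (1 + (l i + s)\<^sup>2)) (at s)" for i
      using DERIV_chain2[OF DERIV_arctan DERIV_add[OF DERIV_const DERIV_ident]] by simp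
    then have "((\<lambda>s. \<Sum>i\<in>UNIV. arctan (l i + s)) has_real_derivative ?d s) (at s)"
      by (intro DERIV_sum) auto
    then have "(?a has_real_derivative ?d s / ?N) (at s)" by (rule DERIV_cdivide)
    then have "((\<lambda>s. tan (?a s)) has_real_derivative inverse ((cos (?a s))\<^sup>2) * (?d s / ?N)) (at s)"
      by (intro DERIV_chain2[OF DERIV_tan]) (use pos in auto)
    then show "((\<lambda>s. tan (?a s) - ?k * s) has_real_derivative
        inverse ((cos (?a s))\<^sup>2) * (?d s / ?N) - ?k * 1) (at s)"
      by (intro DERIV_diff DERIV_cmult DERIV_ident)
    have "(sin \<delta>)\<^sup>2 \<le> inverse ((cos (?a s))\<^sup>2) * ?d s"
      using bound pos by (simp add: field_simps)
    then have "(sin \<delta>)\<^sup>2 / ?N \<le> inverse ((cos (?a s))\<^sup>2) * ?d s / ?N" by (intro divide_right_mono) auto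
    then show "0 \<le> inverse ((cos (?a s))\<^sup>2) * (?d s / ?N) - ?k * 1" by simp
  qed
  have "tan (?a 0) - ?k * 0 \<le> tan (?a t) - ?k * t"
    by (rule DERIV_nonneg_imp_nondecreasing[OF t, of "\<lambda>s. tan (?a s) - ?k * s"]) (rule deriv)
  then show ?thesis by simp
qed

lemma tame_on_tan_tr_arctan:
  assumes \<delta>: "0 < \<delta>" "\<delta> < pi"
  shows "tame_on (F_phase ((real CARD('n) - 2) * (pi / 2) + \<delta>) :: (real ^ 'n ^ 'n) set)
           (\<lambda>A. tan (1 / real CARD('n) * tr_arctan A))"
  unfolding tame_on_def
proof (intro conjI allI impI subequation_F_phase)
  fix t :: real assume t: "t > 0"
  let ?F = "F_phase ((real CARD('n) - 2) * (pi / 2) + \<delta>) :: (real ^ 'n ^ 'n) set"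
  \<comment> \<open>The gain depends on \<delta> and \<open>t\<close> but not on the matrix, which
    is the uniformity that tameness asks for.\<close>
  let ?c = "(sin \<delta>)\<^sup>2 / real CARD('n) * t"
  have "sin \<delta> > 0" using \<delta> by (intro sin_gt_zero)
  then have "?c > 0" using t by simp
  moreover have "tan (1 / real CARD('n) * tr_arctan (A + t *\<^sub>R mat 1)) - tan (1 / real CARD('n) * tr_arctan A) \<ge> ?c"
    if "A \<in> ?F" for A
  proof -
    have A: "A \<in> Sym2" "(real CARD('n) - 2) * (pi / 2) + \<delta> \<le> tr_arctan A"
      using that by (auto simp: F_phase_def)
    obtain v l where v: "is_eigenbasis A v l" using Sym2_eigenbasis_exists[OF A(1)] .
    show ?thesis
      using tan_average_arctan_increment[OF \<delta>, of t l] A(2) t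
      by (simp add: tr_arctan_eigenbasis[OF v] tr_arctan_eigenbasis[OF is_eigenbasis_add_identity[OF v]])
  qed
  ultimately show "\<exists>c>0. \<forall>A\<in>?F. c \<le> tan (1 / real CARD('n) * tr_arctan (A + t *\<^sub>R mat 1))
      - tan (1 / real CARD('n) * tr_arctan A)" by blast
qed

section \<open>Failure of tamability on the lower phases\<close>

definition diag_matrix :: "('n \<Rightarrow> real) \<Rightarrow> real ^ 'n ^ 'n" where
  "diag_matrix d = (\<chi> i j. if i = j then d i else 0)"

lemma diag_matrix_Sym2: "diag_matrix d \<in> Sym2"
  unfolding Sym2_def diag_matrix_def transpose_def by (auto simp: vec_eq_iff)

lemma is_eigenbasis_diag_matrix: "is_eigenbasis (diag_matrix d) (\<lambda>i. axis i 1) d"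
proof -
  have "diag_matrix d *v axis i 1 = d i *\<^sub>R axis i 1" for i
    unfolding matrix_vector_mult_basis by (simp add: column_def diag_matrix_def vec_eq_iff axis_def)
  then show ?thesis by (simp add: is_eigenbasis_def inner_axis_axis)
qed

text \<open>A multiple of the identity with all angles equal to x/n has phase x. Thus the set of
  phases has no gaps, and \<open>h\<close> is strictly increasing on a full interval.\<close>

lemma tr_arctan_attained:
  assumes "\<bar>x\<bar> < real CARD('n) * (pi / 2)"
  obtains A :: "real ^ 'n ^ 'n" where "A \<in> Sym2" "tr_arctan A = x"
proof
  let ?N = "real CARD('n)"
  show "diag_matrix (\<lambda>_ :: 'n. tan (x / ?N)) \<in> Sym2" by (rule diag_matrix_Sym2)
  have "- (pi / 2) < x / ?N" "x / ?N < pi / 2"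
    using assms by (auto simp: field_simps abs_less_iff)
  then show "tr_arctan (diag_matrix (\<lambda>_ :: 'n. tan (x / ?N))) = x"
    by (simp add: tr_arctan_eigenbasis[OF is_eigenbasis_diag_matrix] arctan_tan)
qed

lemma exists_arctan_greater:
  assumes "z < pi / 2"
  obtains r where "z < arctan r"
proof -
  \<comment> \<open>The maximum keeps \<open>y\<close> in the interval where arctan inverts
    tan.\<close>
  have "max z (- (pi / 2)) < pi / 2" using assms pi_gt_zero by (auto simp: max_def)
  then obtain y where "max z (- (pi / 2)) < y" "y < pi / 2" using dense by blast
  then show ?thesis using that[of "tan y"] arctan_tan[of y] by simp
qed

(* Just above the phase (n - 2) pi/2 there are matrices with eigenvalues -r, s, ..., s, with r and s
   large, on which adding the identity changes the phase arbitrarily little. *)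
lemma small_phase_increment:
  assumes N: "CARD('n) \<ge> 2" and x: "(real CARD('n) - 2) * (pi / 2) < x"
  obtains A :: "real ^ 'n ^ 'n" where "A \<in> Sym2" "A + mat 1 \<in> Sym2"
    "(real CARD('n) - 2) * (pi / 2) < tr_arctan A"
    "tr_arctan A < tr_arctan (A + mat 1)" "tr_arctan (A + mat 1) < x"
proof -
  let ?N = "real CARD('n)"
  \<comment> \<open>The n - 1 angles other than that of the negative eigenvalue total at most (n -
    1) pi/2, so this choice of \<open>r'\<close> keeps the phase of A + I below \<open>x\<close>
    whatever \<open>s\<close> is.\<close>
  have "(?N - 1) * (pi / 2) - x < pi / 2" using x by (simp add: field_simps)
  then obtain r' where r': "(?N - 1) * (pi / 2) - x < arctan r'" by (rule exists_arctan_greater)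
  \<comment> \<open>Adding the identity turns the eigenvalue \<open>- r\<close> into
    \<open>- r'\<close>.\<close>
  define r where "r = r' + 1"
  have N1: "?N - 1 > 0" using N by simp
  \<comment> \<open>With \<open>r\<close> fixed, \<open>s\<close> is taken so large that the phase
    of A itself exceeds (n - 2) pi/2.\<close>
  have "(?N - 2) * (pi / 2) + arctan r < (?N - 1) * (pi / 2)"
    using arctan_ubound[of r] by (simp add: field_simps)
  then have "((?N - 2) * (pi / 2) + arctan r) / (?N - 1) < pi / 2"
    using N1 by (simp only: pos_divide_less_eq mult.commute)
  then obtain s where s: "((?N - 2) * (pi / 2) + arctan r) / (?N - 1) < arctan s"
    by (rule exists_arctan_greater)
  then have s: "(?N - 2) * (pi / 2) + arctan r < (?N - 1) * arctan s"
    using N1 by (simp only: pos_divide_less_eq mult.commute)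
  fix j :: 'n
  define d where "d = (\<lambda>i. if i = j then - r else s)"
  have sum_d: "(\<Sum>i\<in>UNIV. arctan (d i + t)) = arctan (t - r) + (?N - 1) * arctan (s + t)" for t
  proof -
    have "(\<Sum>i\<in>UNIV. arctan (d i + t)) = arctan (d j + t) + (\<Sum>i\<in>UNIV - {j}. arctan (d i + t))"
      by (rule sum.remove) auto
    also have "(\<Sum>i\<in>UNIV - {j}. arctan (d i + t)) = (\<Sum>i\<in>UNIV - {j}. arctan (s + t))"
      by (rule sum.cong) (auto simp: d_def)
    also have "\<dots> = (?N - 1) * arctan (s + t)"
      by (simp add: card_Diff_singleton Suc_leI)
    finally show ?thesis by (simp add: d_def)
  qed
  let ?A = "diag_matrix d"
  have fA: "tr_arctan ?A = - arctan r + (?N - 1) * arctan s"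
    using sum_d[of 0] by (simp add: tr_arctan_eigenbasis[OF is_eigenbasis_diag_matrix] arctan_minus)
  have fA1: "tr_arctan (?A + mat 1) = - arctan r' + (?N - 1) * arctan (s + 1)"
    using sum_d[of 1] tr_arctan_eigenbasis[OF is_eigenbasis_add_identity[OF is_eigenbasis_diag_matrix], of d 1]
    by (simp add: r_def arctan_minus)
  have 1: "(?N - 1) * arctan (s + 1) \<le> (?N - 1) * (pi / 2)"
    using N1 arctan_ubound[of "s + 1"] by (intro mult_left_mono) auto
  have 2: "(?N - 1) * arctan s \<le> (?N - 1) * arctan (s + 1)"
    using N1 by (intro mult_left_mono arctan_monotone') auto
  \<comment> \<open>The shifted negative eigenvalue supplies the strict increase of the
    phase.\<close>
  have 3: "arctan r' < arctan r" by (simp add: r_def arctan_less_iff)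
  show ?thesis
  proof (rule that)
    show "?A \<in> Sym2" by (rule diag_matrix_Sym2)
    show "?A + mat 1 \<in> Sym2" using Sym2_add[OF diag_matrix_Sym2 Sym2_scaled_identity, of d 1] by simp
    show "(?N - 2) * (pi / 2) < tr_arctan ?A" using s by (simp add: fA)
    show "tr_arctan ?A < tr_arctan (?A + mat 1)" using 2 3 by (simp add: fA fA1)
    show "tr_arctan (?A + mat 1) < x" using 1 r' by (simp add: fA1)
  qed
qed

lemma not_tamable_on_low_phase:
  assumes \<theta>: "- real CARD('n) * (pi / 2) < \<theta>" "\<theta> \<le> (real CARD('n) - 2) * (pi / 2)"
  shows "\<not> tamable_on (F_phase \<theta> :: (real ^ 'n ^ 'n) set) tr_arctan"
proof
  let ?F = "F_phase \<theta> :: (real ^ 'n ^ 'n) set"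
  let ?N = "real CARD('n)"
  let ?p = "(?N - 2) * (pi / 2)"
  assume "tamable_on ?F tr_arctan"
  then obtain h where mono: "strict_mono_on (tr_arctan ` ?F) h" and "tame_on ?F (h \<circ> tr_arctan)"
    unfolding tamable_on_def by blast
  then have "\<exists>c>0. \<forall>A\<in>?F. c \<le> (h \<circ> tr_arctan) (A + 1 *\<^sub>R mat 1) - (h \<circ> tr_arctan) A"
    unfolding tame_on_def using zero_less_one by blast
  then obtain c where c: "c > 0"
      "\<And>A. A \<in> ?F \<Longrightarrow> c \<le> h (tr_arctan (A + mat 1)) - h (tr_arctan A)" by auto
  \<comment> \<open>A phase at most (n - 2) pi/2 but above -n pi/2 forces n to be at least
    2.\<close>
  have "- ?N * (pi / 2) < ?p" using \<theta> by linarith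
  then have "2 * (?N - 1) * (pi / 2) > 0" by (simp add: field_simps)
  then have N: "CARD('n) \<ge> 2" by (simp add: zero_less_mult_iff)
  have range: "x \<in> tr_arctan ` ?F" if "\<theta> \<le> x" "x < ?N * (pi / 2)" for x
  proof -
    have "\<bar>x\<bar> < ?N * (pi / 2)" using that \<theta> by (simp add: abs_less_iff)
    then obtain A :: "real ^ 'n ^ 'n" where "A \<in> Sym2" "tr_arctan A = x" by (rule tr_arctan_attained)
    then show ?thesis using that by (auto simp: F_phase_def intro!: image_eqI[of _ _ A])
  qed
  have p: "?p < ?N * (pi / 2)" by (simp add: algebra_simps)
  \<comment> \<open>\<open>Inf ?H\<close> plays the role of the right limit of \<open>h\<close> at
    \<open>?p\<close>; it is finite because \<open>?p\<close> is itself a phase on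
    \<open>?F\<close>, so \<open>h ?p\<close> is a lower bound.\<close>
  let ?H = "h ` {?p<..<?N * (pi / 2)}"
  have "bdd_below ?H"
  proof (rule bdd_belowI2)
    fix x assume "x \<in> {?p<..<?N * (pi / 2)}"
    then show "h ?p \<le> h x"
      using strict_mono_onD[OF mono range range, of ?p x] \<theta> by simp
  qed
  have "?H \<noteq> {}" using p by simp
  then have "\<exists>y\<in>?H. y < Inf ?H + c" using c(1) by (intro cInf_lessD) auto
  then obtain x where x: "?p < x" "x < ?N * (pi / 2)" "h x < Inf ?H + c" by auto
  obtain A :: "real ^ 'n ^ 'n" where A: "A \<in> Sym2" "A + mat 1 \<in> Sym2"
    "?p < tr_arctan A" "tr_arctan A < tr_arctan (A + mat 1)" "tr_arctan (A + mat 1) < x"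
    using small_phase_increment[OF N x(1)] .
  have F: "A \<in> ?F" "A + mat 1 \<in> ?F" using A \<theta> by (auto simp: F_phase_def)
  \<comment> \<open>Both phases lie between \<open>?p\<close> and \<open>x\<close>, so
    \<open>h\<close> takes values there in an interval shorter than \<open>c\<close>.\<close>
  have "Inf ?H \<le> h (tr_arctan A)"
    using A x by (intro cInf_lower \<open>bdd_below ?H\<close>) auto
  moreover have "h (tr_arctan (A + mat 1)) < h x"
    using A x \<theta> F by (intro strict_mono_onD[OF mono] range) auto
  ultimately show False using c(2)[OF F(1)] x(3) by linarith
qed

section \<open>The equivalence and the explicit tame function\<close>

theorem theorem6p1:
  fixes \<theta> :: real
  assumes "\<theta> \<in> {- real CARD('n::finite) * (pi / 2) <..< real CARD('n) * (pi / 2)}"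
  shows "(tamable_on (F_phase \<theta> :: (real ^ 'n ^ 'n) set) tr_arctan \<longleftrightarrow>
            \<theta> \<in> {(real CARD('n) - 2) * (pi / 2) <..< real CARD('n) * (pi / 2)})
       \<and> (\<forall>\<delta>>0. \<theta> = (real CARD('n) - 2) * (pi / 2) + \<delta> \<longrightarrow>
            tame_on (F_phase \<theta> :: (real ^ 'n ^ 'n) set)
              (\<lambda>A. tan (1 / real CARD('n) * tr_arctan A))
          \<and> (F_phase \<theta> :: (real ^ 'n ^ 'n) set) =
              {A \<in> Sym2. tr_arctan A \<in> {(real CARD('n) - 2) * (pi / 2) + \<delta> ..< real CARD('n) * (pi / 2)}})"
proof -
  let ?F = "F_phase \<theta> :: (real ^ 'n ^ 'n) set" and ?N = "real CARD('n)"
  let ?g = "\<lambda>A :: real ^ 'n ^ 'n. tan (1 / ?N * tr_arctan A)"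
  have \<theta>: "- ?N * (pi / 2) < \<theta>" "\<theta> < ?N * (pi / 2)" using assms by auto
  have tame: "tame_on ?F ?g" if "(?N - 2) * (pi / 2) < \<theta>"
  proof -
    \<comment> \<open>This difference is \<delta>; it is below pi because \<theta> is below n
      pi/2.\<close>
    have "0 < \<theta> - (?N - 2) * (pi / 2)" "\<theta> - (?N - 2) * (pi / 2) < pi"
      using that \<theta>(2) by (simp_all add: algebra_simps)
    from tame_on_tan_tr_arctan[where 'n = 'n, OF this] show ?thesis by simp
  qed
  have "tamable_on ?F tr_arctan" if "(?N - 2) * (pi / 2) < \<theta>"
    unfolding tamable_on_def
  proof (intro exI conjI)
    \<comment> \<open>Every phase divided by n lies strictly between -pi/2 and pi/2, a single branch
      on which tan is strictly increasing.\<close>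
    let ?h = "\<lambda>x. tan (1 / ?N * x)"
    show "strict_mono_on (tr_arctan ` ?F) ?h"
    proof (rule strict_mono_onI)
      fix x y assume xy: "x \<in> tr_arctan ` ?F" "y \<in> tr_arctan ` ?F" "x < y"
      then have "\<bar>x\<bar> < ?N * (pi / 2)" "\<bar>y\<bar> < ?N * (pi / 2)"
        using tr_arctan_less[where 'n = 'n] by (auto simp only: F_phase_def mem_Collect_eq)
      then show "?h x < ?h y"
        using xy(3) by (intro tan_monotone) (auto simp: field_simps abs_less_iff)
    qed
    show "tame_on ?F (?h \<circ> tr_arctan)" using tame[OF that] by (simp add: comp_def)
  qed
  moreover have "(?N - 2) * (pi / 2) < \<theta>" if "tamable_on ?F tr_arctan"
    using not_tamable_on_low_phase[OF \<theta>(1)] that by (meson not_le)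
  moreover have "tr_arctan A < ?N * (pi / 2)" if "A \<in> Sym2" for A :: "real ^ 'n ^ 'n"
    using tr_arctan_less[OF that] by linarith
  then have "?F = {A \<in> Sym2. tr_arctan A \<in> {\<theta> ..< ?N * (pi / 2)}}"
    unfolding F_phase_def by auto
  ultimately show ?thesis using tame \<theta>(2) by auto
qed

end
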